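(* Let $n>1$ be an integer. Then \[ \sum_{k=0}^{n-1}\frac{(q;q^6)_k^2\,(q^4;q^6)_k\, q^{6k}}{(q^6;q^6)_k^3}\equiv 0 \pmod{\Phi_n(q)^2}\quad\text{if } n\equiv 5\pmod 6, \] and \[ \sum_{k=0}^{n-1}\frac{(q^{-1};q^6)_k^2\,(q^{-4};q^6)_k\, q^{6k}}{(q^6;q^6)_k^3}\equiv 0 \pmod{\Phi_n(q)^2}\quad\text{if } n\equiv 1\pmod 6. \]
   Context: $(a;q)_k=(1-a)(1-aq)\cdots(1-aq^{k-1})$ (with $(a;q)_0=1$) is the $q$-shifted factorial; $\Phi_n(q)$ is the $n$-th cyclotomic polynomial. A congruence of a rational function in $q$ modulo a polynomial $P(q)$, where the denominator is coprime to $P(q)$, means that $P(q)$ divides the numerator (in the ring of Laurent polynomials in $q$ with rational coefficients). *)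

theory Defs
  imports
    Complex_Main
    "HOL-Computational_Algebra.Computational_Algebra"
    "HOL-Number_Theory.Cong"
begin

definition qpoch :: "'a::comm_ring_1 \<Rightarrow> 'a \<Rightarrow> nat \<Rightarrow> 'a" where
  "qpoch a q k = (\<Prod>j<k. 1 - a * q ^ j)"

definition qvar :: "rat poly fract" where
  "qvar = to_fract [:0, 1:]"

text \<open>The ring of Laurent polynomials is realised as a subring of the field of
  rational functions.\<close>

definition laurent_polys :: "rat poly fract set" where
  "laurent_polys = {to_fract p / qvar ^ m | p m. True}"

definition laurent_dvd :: "rat poly fract \<Rightarrow> rat poly fract \<Rightarrow> bool" where
  "laurent_dvd a b \<longleftrightarrow> (\<exists>c\<in>laurent_polys. b = a * c)"

definition laurent_coprime :: "rat poly fract \<Rightarrow> rat poly fract \<Rightarrow> bool" where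
  "laurent_coprime a b \<longleftrightarrow>
     (\<forall>d\<in>laurent_polys. laurent_dvd d a \<longrightarrow> laurent_dvd d b \<longrightarrow> laurent_dvd d 1)"

text \<open>The choice of the representation \<open>A / B\<close> does not matter: for denominators coprime
  to \<open>P\<close>, divisibility of the numerator by \<open>P\<close> is independent of it.\<close>

definition ratfun_cong :: "rat poly fract \<Rightarrow> rat poly fract \<Rightarrow> rat poly \<Rightarrow> bool" where
  "ratfun_cong f g P \<longleftrightarrow>
     (\<exists>A\<in>laurent_polys. \<exists>B\<in>laurent_polys. B \<noteq> 0 \<and> f - g = A / B \<and>
        laurent_coprime B (to_fract P) \<and> laurent_dvd (to_fract P) A)"

definition primitive_unity_roots :: "nat \<Rightarrow> complex set" where
  "primitive_unity_roots n = {z. z ^ n = 1 \<and> (\<forall>m. 0 < m \<and> m < n \<longrightarrow> z ^ m \<noteq> 1)}"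

text \<open>For \<open>n > 0\<close> the product of \<open>X - z\<close> over the primitive \<open>n\<close>-th roots of unity has
  rational coefficients, so that the description below determines a unique polynomial;
  see \<open>map_poly_cyclotomic\<close>.\<close>

definition cyclotomic :: "nat \<Rightarrow> rat poly" where
  "cyclotomic n = (THE p. map_poly of_rat p = (\<Prod>z\<in>primitive_unity_roots n. [:-z, 1:]))"

lemma map_poly_of_rat_add:
  "map_poly (of_rat :: rat \<Rightarrow> complex) (p + q) = map_poly of_rat p + map_poly of_rat q"
  by (rule poly_eqI) (simp add: coeff_map_poly of_rat_add)

lemma map_poly_of_rat_diff:
  "map_poly (of_rat :: rat \<Rightarrow> complex) (p - q) = map_poly of_rat p - map_poly of_rat q"
  by (rule poly_eqI) (simp add: coeff_map_poly of_rat_diff)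

lemma map_poly_of_rat_mult:
  "map_poly (of_rat :: rat \<Rightarrow> complex) (p * q) = map_poly of_rat p * map_poly of_rat q"
  by (rule poly_eqI) (simp add: coeff_map_poly coeff_mult of_rat_sum of_rat_mult)

lemma map_poly_of_rat_prod:
  "map_poly (of_rat :: rat \<Rightarrow> complex) (\<Prod>x\<in>S. f x) = (\<Prod>x\<in>S. map_poly of_rat (f x))"
  by (induction S rule: infinite_finite_induct) (simp_all add: map_poly_of_rat_mult)

lemma map_poly_of_rat_inj:
  assumes "map_poly (of_rat :: rat \<Rightarrow> complex) p = map_poly of_rat q"
  shows "p = q"
proof (rule poly_eqI)
  fix i
  have "coeff (map_poly (of_rat :: rat \<Rightarrow> complex) p) i = coeff (map_poly of_rat q) i"
    using assms by simp
  then show "coeff p i = coeff q i" by (simp add: coeff_map_poly)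
qed

lemma finite_primitive_unity_roots:
  assumes "n > 0" shows "finite (primitive_unity_roots n)"
proof (rule finite_subset)
  show "primitive_unity_roots n \<subseteq> {z. z ^ n = 1}" by (auto simp: primitive_unity_roots_def)
  show "finite {z::complex. z ^ n = 1}" using assms by (intro finite_roots_unity) auto
qed

lemma unity_poly_eq_prod_roots:
  assumes n: "n > 0"
  shows "monom 1 n - 1 = (\<Prod>z\<in>{z::complex. z ^ n = 1}. [:-z, 1:])"
proof -
  let ?R = "{z::complex. z ^ n = 1}"
  let ?P = "\<Prod>z\<in>?R. [:-z, 1:]"
  have fin: "finite ?R" using n by (intro finite_roots_unity) auto
  have card: "card ?R = n" using n by (simp add: card_roots_unity_eq)
  have deg: "degree ?P = n"
    using card by (subst degree_prod_eq_sum_degree) auto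
  have lc: "coeff ?P n = 1"
  proof -
    have "lead_coeff ?P = (\<Prod>z\<in>?R. lead_coeff [:-z, 1:])" by (rule lead_coeff_prod)
    then show ?thesis using deg by simp
  qed
  let ?D = "monom 1 n - 1 - ?P"
  have "?D = 0"
  proof (rule ccontr)
    assume nz: "?D \<noteq> 0"
    have "degree ?D \<le> n"
      using deg by (intro degree_diff_le) (auto simp: degree_monom_eq)
    moreover have "coeff ?D n = 0" using lc n by simp
    ultimately have "degree ?D < n"
      using nz n by (metis leading_coeff_0_iff order_le_less)
    moreover have "?R \<subseteq> {z. poly ?D z = 0}"
      using fin by (auto simp: poly_monom poly_prod prod_zero_iff)
    then have "card ?R \<le> card {z. poly ?D z = 0}"
      using poly_roots_finite[OF nz] by (rule card_mono[rotated])
    moreover have "card {z. poly ?D z = 0} \<le> degree ?D" by (rule card_poly_roots_bound[OF nz])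
    ultimately show False using card by simp
  qed
  then show ?thesis by simp
qed

lemma unity_roots_eq_Union:
  assumes n: "n > 0"
  shows "{z::complex. z ^ n = 1} = (\<Union>d\<in>{d. d dvd n}. primitive_unity_roots d)"
proof (intro equalityI subsetI)
  fix z :: complex assume "z \<in> {z. z ^ n = 1}"
  then have z: "z ^ n = 1" by simp
  define d where "d = (LEAST m. 0 < m \<and> z ^ m = 1)"
  have d: "0 < d \<and> z ^ d = 1"
    unfolding d_def by (rule LeastI[of _ n]) (use n z in simp)
  have least: "z ^ m \<noteq> 1" if "0 < m" "m < d" for m
    using not_less_Least[of m "\<lambda>m. 0 < m \<and> z ^ m = 1"] that unfolding d_def by blast
  have "z ^ n = z ^ (d * (n div d) + n mod d)" by simp
  also have "\<dots> = z ^ (n mod d)" using d by (simp only: power_add power_mult) simp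
  finally have "n mod d = 0" using least[of "n mod d"] z d by (cases "n mod d = 0") auto
  then show "z \<in> (\<Union>d\<in>{d. d dvd n}. primitive_unity_roots d)"
    using d least by (auto simp: primitive_unity_roots_def)
next
  fix z :: complex assume "z \<in> (\<Union>d\<in>{d. d dvd n}. primitive_unity_roots d)"
  then obtain d where "d dvd n" "z ^ d = 1" by (auto simp: primitive_unity_roots_def)
  then show "z \<in> {z. z ^ n = 1}" by (auto simp: power_mult elim!: dvdE)
qed

lemma unity_poly_eq_prod_primitive:
  assumes n: "n > 0"
  shows "monom 1 n - 1 = (\<Prod>d | d dvd n. \<Prod>z\<in>primitive_unity_roots d. [:-z, 1:])"
proof -
  have pos: "d > 0" if "d dvd n" for d using that n by (auto intro: Nat.gr0I)
  have disj: "primitive_unity_roots d \<inter> primitive_unity_roots e = {}"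
    if "d dvd n" "e dvd n" "d \<noteq> e" for d e
    using that pos[of d] pos[of e]
    by (cases d e rule: linorder_cases) (auto simp: primitive_unity_roots_def)
  have "finite {d. d dvd n}" using n by simp
  then show ?thesis
    unfolding unity_poly_eq_prod_roots[OF n] unity_roots_eq_Union[OF n]
    using disj finite_primitive_unity_roots pos by (intro prod.UNION_disjoint) auto
qed

lemma rational_cyclotomic:
  assumes "n > 0"
  shows "\<exists>p. map_poly of_rat p = (\<Prod>z\<in>primitive_unity_roots n. [:-z, 1:])"
  using assms
proof (induction n rule: less_induct)
  case (less n)
  let ?m = "map_poly (of_rat :: rat \<Rightarrow> complex)"
  let ?C = "\<lambda>n. \<Prod>z\<in>primitive_unity_roots n. [:-z, 1:]"
  define S where "S = {d. d dvd n \<and> d \<noteq> n}"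
  have "\<forall>d\<in>S. \<exists>p. ?m p = ?C d"
  proof
    fix d assume "d \<in> S"
    then have "d dvd n" "d \<noteq> n" by (auto simp: S_def)
    then have "d < n" "d > 0" using less.prems by (auto dest: dvd_imp_le intro: Nat.gr0I)
    then show "\<exists>p. ?m p = ?C d" by (rule less.IH)
  qed
  then obtain F where F: "\<And>d. d \<in> S \<Longrightarrow> ?m (F d) = ?C d" by metis
  define B where "B = (\<Prod>d\<in>S. F d)"
  have mB: "?m B = (\<Prod>d\<in>S. ?C d)"
    unfolding B_def map_poly_of_rat_prod using F by (intro prod.cong) auto
  define A :: "rat poly" where "A = monom 1 n - 1"
  have mA: "?m A = monom 1 n - 1"
    unfolding A_def map_poly_of_rat_diff by (simp add: map_poly_monom)
  have "{d. d dvd n} = insert n S" by (auto simp: S_def)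
  moreover have "finite S" using less.prems by (simp add: S_def)
  moreover have "n \<notin> S" by (simp add: S_def)
  ultimately have AB: "?m A = ?m B * ?C n"
    using unity_poly_eq_prod_primitive[OF less.prems] mA mB by (simp add: mult.commute)
  have "?C d \<noteq> 0" for d
    by (cases "finite (primitive_unity_roots d)") (auto simp: prod_zero_iff)
  then have "?m B \<noteq> 0"
    unfolding mB using \<open>finite S\<close> by (subst prod_zero_iff) auto
  then have B0: "B \<noteq> 0" by auto
  have "?m A = ?m (B * (A div B) + A mod B)" by simp
  also have "\<dots> = ?m B * ?m (A div B) + ?m (A mod B)"
    by (simp only: map_poly_of_rat_add map_poly_of_rat_mult)
  finally have eq: "?m B * (?C n - ?m (A div B)) = ?m (A mod B)"
    using AB by (simp add: algebra_simps)
  have "?C n - ?m (A div B) = 0"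
  proof (rule ccontr)
    assume nz: "?C n - ?m (A div B) \<noteq> 0"
    then have "?m (A mod B) \<noteq> 0" using eq \<open>?m B \<noteq> 0\<close> by (metis mult_eq_0_iff)
    then have "A mod B \<noteq> 0" by auto
    then have "degree (A mod B) < degree B" using B0 degree_mod_less by blast
    moreover have dm: "degree (?m p) = degree p" for p by (rule degree_map_poly) simp
    moreover have "degree (?m B) \<le> degree (?m (A mod B))"
      unfolding eq[symmetric] using nz \<open>?m B \<noteq> 0\<close> by (subst degree_mult_eq) auto
    ultimately show False by simp
  qed
  then show ?case by (metis eq_iff_diff_eq_0)
qed

lemma map_poly_cyclotomic:
  assumes "n > 0"
  shows "map_poly of_rat (cyclotomic n) = (\<Prod>z\<in>primitive_unity_roots n. [:-z, 1:])"
proof -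
  obtain p where p: "map_poly of_rat p = (\<Prod>z\<in>primitive_unity_roots n. [:-z, 1:])"
    using rational_cyclotomic[OF assms] by blast
  then show ?thesis
    unfolding cyclotomic_def by (rule theI) (use p in \<open>auto intro!: map_poly_of_rat_inj\<close>)
qed

end

theory Submission
  imports Defs "HOL-Computational_Algebra.Field_as_Ring"
begin

text \<open>Put \<open>p = q\<^sup>6\<close>, \<open>x = q\<^bsup>5n\<^esup>\<close> and replace the square \<open>(a; p)\<^sub>k\<^sup>2\<close> by
  \<open>(a / x; p)\<^sub>k (a x; p)\<^sub>k\<close>. Since \<open>\<Phi>\<^sub>n\<close> divides \<open>1 - x\<close> and \<open>x + 1 / x - 2 = (1 - x)\<^sup>2 / x\<close>,
  this does not change the sum modulo \<open>\<Phi>\<^sub>n\<^sup>2\<close>. Now \<open>a / x = p\<^bsup>-N\<^esup>\<close> with \<open>N < n\<close>, so the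
  sum terminates. For \<open>a = q\<close> it is balanced, and the \<open>q\<close>-Pfaff-Saalschuetz formula evaluates
  it to a product two of whose factors are divisible by \<open>\<Phi>\<^sub>n\<close>. For \<open>a = q\<^bsup>-1\<^esup>\<close> it misses
  balance by \<open>p\<^sup>2\<close>; two contiguous relations turn it into a combination of three balanced sums,
  each of which is divisible by \<open>\<Phi>\<^sub>n\<^sup>2\<close> in the same way.\<close>

section \<open>The \<open>q\<close>-Pfaff-Saalschuetz sum\<close>

lemma qpoch_0 [simp]: "qpoch a q 0 = 1"
  by (simp add: qpoch_def)

lemma qpoch_Suc: "qpoch a q (Suc k) = qpoch a q k * (1 - a * q ^ k)"
  by (simp add: qpoch_def)

lemma qpoch_self_nonzero:
  fixes p :: "'a::field"
  assumes "\<And>i. 0 < i \<Longrightarrow> p ^ i \<noteq> 1"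
  shows "qpoch p p k \<noteq> 0"
  using assms[of "Suc _"] by (auto simp: qpoch_def)

text \<open>The coefficient of \<open>z ^ j\<close> in \<open>(z; p)\<^sub>\<infinity> / (g z; p)\<^sub>\<infinity>\<close>, by the \<open>q\<close>-binomial theorem.\<close>

definition qbin_coeff :: "'a::field \<Rightarrow> 'a \<Rightarrow> nat \<Rightarrow> 'a" where
  "qbin_coeff p g j = (\<Prod>i<j. g - p ^ i) / qpoch p p j"

lemma qbin_coeff_0 [simp]: "qbin_coeff p g 0 = 1"
  by (simp add: qbin_coeff_def)

lemma qbin_coeff_Suc:
  "qbin_coeff p g (Suc j) = qbin_coeff p g j * (g - p ^ j) / (1 - p ^ Suc j)"
  by (simp add: qbin_coeff_def qpoch_Suc)

text \<open>Since \<open>(g z; p)\<^sub>\<infinity> = (1 - g z) (p g z;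
  p)\<^sub>\<infinity>\<close>, passing from \<open>g\<close> to \<open>p * g\<close> multiplies the
  generating function by \<open>1 - g z\<close>; this is the resulting relation between
  coefficients.\<close>

lemma qbin_coeff_shift:
  fixes p g :: "'a::field"
  assumes p: "\<And>i. 0 < i \<Longrightarrow> p ^ i \<noteq> 1"
  shows "qbin_coeff p (p * g) (Suc j) = qbin_coeff p g (Suc j) - g * qbin_coeff p g j"
proof (induction j)
  case 0
  then show ?case using p[of 1] by (simp add: qbin_coeff_Suc field_simps)
next
  case (Suc j)
  have nz: "1 - p ^ Suc j \<noteq> 0" "1 - p ^ Suc (Suc j) \<noteq> 0"
    using p[of "Suc j"] p[of "Suc (Suc j)"] by auto
  have "qbin_coeff p (p * g) (Suc (Suc j)) =
      (qbin_coeff p g (Suc j) - g * qbin_coeff p g j) * (p * g - p ^ Suc j) / (1 - p ^ Suc (Suc j))"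
    by (simp only: qbin_coeff_Suc[of _ _ "Suc j"] Suc)
  also have "\<dots> = qbin_coeff p g (Suc (Suc j)) - g * qbin_coeff p g (Suc j)"
    unfolding qbin_coeff_Suc using nz by (simp add: divide_simps) (simp add: algebra_simps)
  finally show ?case .
qed

text \<open>This is the coefficient of \<open>z ^ N\<close> in
  \<open>(z; p)\<^sub>\<infinity> / (g z; p)\<^sub>\<infinity>\<close> times the basic
  hypergeometric series 2phi1 with upper parameters \<open>a\<close>, \<open>b\<close>, lower
  parameter \<open>p\<close>, base \<open>p\<close> and argument \<open>z\<close>. Terminating sums
  have \<open>g = p ^ N\<close>; a free \<open>g\<close> lets \<open>N\<close> vary with
  \<open>g\<close> fixed and conversely.\<close>

definition qconv :: "'a::field \<Rightarrow> 'a \<Rightarrow> 'a \<Rightarrow> 'a \<Rightarrow> nat \<Rightarrow> 'a" where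
  "qconv p a b g N =
     (\<Sum>k\<le>N. qpoch a p k * qpoch b p k / (qpoch p p k)\<^sup>2 * qbin_coeff p g (N - k))"

text \<open>The contiguous relation that repairs missing balance. The terms with
  \<open>k \<le> N\<close> change by \<open>qbin_coeff_shift\<close>; the term
  \<open>k = Suc N\<close> carries \<open>qbin_coeff p g 0 = 1\<close> whatever \<open>g\<close>
  is.\<close>

lemma qconv_shift:
  fixes p a b g :: "'a::field"
  assumes p: "\<And>i. 0 < i \<Longrightarrow> p ^ i \<noteq> 1"
  shows "qconv p a b (p * g) (Suc N) = qconv p a b g (Suc N) - g * qconv p a b g N"
proof -
  let ?u = "\<lambda>k. qpoch a p k * qpoch b p k / (qpoch p p k)\<^sup>2"
  have "?u k * qbin_coeff p (p * g) (Suc N - k) =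
      ?u k * qbin_coeff p g (Suc N - k) - g * (?u k * qbin_coeff p g (N - k))" if "k \<le> N" for k
    by (simp only: Suc_diff_le[OF that] qbin_coeff_shift[OF p] right_diff_distrib mult.left_commute)
  then have "(\<Sum>k\<le>N. ?u k * qbin_coeff p (p * g) (Suc N - k)) =
      (\<Sum>k\<le>N. ?u k * qbin_coeff p g (Suc N - k)) - g * (\<Sum>k\<le>N. ?u k * qbin_coeff p g (N - k))"
    by (simp add: sum_subtractf sum_distrib_left)
  then show ?thesis by (simp add: qconv_def)
qed

text \<open>The right-hand side is the WZ certificate of the first-order recurrence below.\<close>

lemma qconv_partial_sum:
  fixes p a b g :: "'a::field"
  assumes p: "\<And>i. 0 < i \<Longrightarrow> p ^ i \<noteq> 1" and g: "a * b = p * g"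
  defines "u \<equiv> \<lambda>k. qpoch a p k * qpoch b p k / (qpoch p p k)\<^sup>2"
  shows "(\<Sum>k\<le>j. u k * ((1 - p ^ Suc (j + d))\<^sup>2 * qbin_coeff p g (Suc (j + d) - k)
              - (g - p ^ (j + d) * (a + b) + p * (p ^ (j + d))\<^sup>2) * qbin_coeff p g (j + d - k)))
       = - (p ^ d * u j * (1 - a * p ^ j) * (1 - b * p ^ j) * qbin_coeff p g d)"
proof (induction j arbitrary: d)
  case 0
  define D where "D = p ^ d"
  have nz: "1 - p * D \<noteq> 0" using p[of "Suc d"] by (simp add: D_def)
  have u0: "u 0 = 1" by (simp add: u_def)
  \<comment> \<open>The claim with \<open>qbin_coeff p g d\<close> split off and
    \<open>1 - p * D\<close> cleared: a polynomial identity modulo the balance condition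
    \<open>a * b = p * g\<close>.\<close>
  have "(1 - p * D)\<^sup>2 * (g - D) - (g - D * (a + b) + p * D\<^sup>2) * (1 - p * D)
      = - (D * (1 - a) * (1 - b)) * (1 - p * D)"
    using g by algebra
  then have "(1 - p * D)\<^sup>2 * ((g - D) / (1 - p * D)) - (g - D * (a + b) + p * D\<^sup>2)
      = - (D * (1 - a) * (1 - b))"
    using nz by (simp add: divide_simps)
  then have "qbin_coeff p g d * ((1 - p * D)\<^sup>2 * ((g - D) / (1 - p * D)) - (g - D * (a + b) + p * D\<^sup>2))
      = qbin_coeff p g d * - (D * (1 - a) * (1 - b))"
    by simp
  then show ?case
    by (simp add: u0 qbin_coeff_Suc D_def algebra_simps)
next
  case (Suc j)
  define K where "K = p ^ j"
  define D where "D = p ^ d"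
  define W where "W = qbin_coeff p g d"
  define U where "U = u (Suc j)"
  have nz: "1 - p * D \<noteq> 0" "1 - p * K \<noteq> 0"
    using p[of "Suc d"] p[of "Suc j"] by (simp_all add: D_def K_def)
  have W1: "qbin_coeff p g (Suc d) = W * ((g - D) / (1 - p * D))"
    by (simp add: qbin_coeff_Suc W_def D_def)
  have U1: "u j * (1 - a * K) * (1 - b * K) = U * (1 - p * K)\<^sup>2"
    using nz qpoch_self_nonzero[OF p]
    by (simp add: U_def u_def qpoch_Suc K_def divide_simps power_mult_distrib)
  have M: "p ^ (Suc j + d) = p * K * D"
    by (simp add: K_def D_def power_add)
  have "- (p * D * (1 - p * K)\<^sup>2 * (g - D)) + ((1 - p * (p * K * D))\<^sup>2 * (g - D)
        - (g - p * K * D * (a + b) + p * (p * K * D)\<^sup>2) * (1 - p * D))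
      = - (D * (1 - a * (p * K)) * (1 - b * (p * K))) * (1 - p * D)"
    using g by algebra
  then have key: "- (p * D * (1 - p * K)\<^sup>2 * ((g - D) / (1 - p * D)))
        + ((1 - p * (p * K * D))\<^sup>2 * ((g - D) / (1 - p * D))
           - (g - p * K * D * (a + b) + p * (p * K * D)\<^sup>2))
      = - (D * (1 - a * (p * K)) * (1 - b * (p * K)))"
    using nz by (simp add: divide_simps)
  let ?s = "\<lambda>N k. u k * ((1 - p ^ Suc N)\<^sup>2 * qbin_coeff p g (Suc N - k)
              - (g - p ^ N * (a + b) + p * (p ^ N)\<^sup>2) * qbin_coeff p g (N - k))"
  have "(\<Sum>k\<le>Suc j. ?s (Suc j + d) k) = (\<Sum>k\<le>j. ?s (j + Suc d) k) + ?s (Suc j + d) (Suc j)"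
    by simp
  \<comment> \<open>The induction hypothesis is taken at \<open>Suc d\<close>, because the order
    \<open>j + d\<close> of the convolution has to stay at \<open>Suc j + d\<close> while the
    summation range shrinks.\<close>
  also have "(\<Sum>k\<le>j. ?s (j + Suc d) k) =
      - (p ^ Suc d * (u j * (1 - a * p ^ j) * (1 - b * p ^ j)) * qbin_coeff p g (Suc d))"
    by (subst Suc) (simp add: mult.assoc)
  also have "\<dots> = U * W * - (p * D * (1 - p * K)\<^sup>2 * ((g - D) / (1 - p * D)))"
    unfolding W1 K_def[symmetric] U1 by (simp add: D_def)
  also have "?s (Suc j + d) (Suc j) = U * W * ((1 - p * (p * K * D))\<^sup>2 * ((g - D) / (1 - p * D))
           - (g - p * K * D * (a + b) + p * (p * K * D)\<^sup>2))"
  proof -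
    have "Suc (Suc j + d) - Suc j = Suc d" "Suc j + d - Suc j = d" by simp_all
    then show ?thesis
      unfolding power_Suc[of p "Suc j + d"] M W1 U_def[symmetric] by (simp only: W1 W_def[symmetric]) (simp add: right_diff_distrib mult_ac)
  qed
  finally have "(\<Sum>k\<le>Suc j. ?s (Suc j + d) k) = U * W * - (D * (1 - a * (p * K)) * (1 - b * (p * K)))"
    using key by (simp only: distrib_left[symmetric])
  then show ?case by (simp add: U_def W_def D_def K_def algebra_simps)
qed

text \<open>In \<open>qconv_partial_sum\<close> with \<open>j = N\<close> and \<open>d = 0\<close>,
  only the term \<open>k = Suc N\<close> of the longer convolution is missing; multiplied by
  \<open>(1 - p ^ Suc N)\<^sup>2\<close> it cancels the right-hand side.\<close>

lemma qconv_saalschutz_Suc: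
  fixes p a b g :: "'a::field"
  assumes p: "\<And>i. 0 < i \<Longrightarrow> p ^ i \<noteq> 1" and g: "a * b = p * g"
  shows "(1 - p ^ Suc N)\<^sup>2 * qconv p a b g (Suc N) =
     (g - p ^ N * (a + b) + p * (p ^ N)\<^sup>2) * qconv p a b g N"
proof -
  let ?u = "\<lambda>k. qpoch a p k * qpoch b p k / (qpoch p p k)\<^sup>2"
  have u: "(1 - p ^ Suc N)\<^sup>2 * ?u (Suc N) = ?u N * (1 - a * p ^ N) * (1 - b * p ^ N)"
    using qpoch_self_nonzero[OF p] p[of "Suc N"]
    by (simp add: qpoch_Suc divide_simps power_mult_distrib)
  have "(1 - p ^ Suc N)\<^sup>2 * (\<Sum>k\<le>N. ?u k * qbin_coeff p g (Suc N - k))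
      - (g - p ^ N * (a + b) + p * (p ^ N)\<^sup>2) * qconv p a b g N
      = - (?u N * (1 - a * p ^ N) * (1 - b * p ^ N))"
    using qconv_partial_sum[OF p g, of N 0]
    by (simp add: qconv_def right_diff_distrib sum_subtractf sum_distrib_left mult.left_commute)
  moreover have "qconv p a b g (Suc N) =
      (\<Sum>k\<le>N. ?u k * qbin_coeff p g (Suc N - k)) + ?u (Suc N)"
    by (simp add: qconv_def)
  moreover have "x + z = y" if "x - y = - z" for x y z :: 'a
    using that by (simp add: diff_eq_eq)
  ultimately show ?thesis
    by (simp only: distrib_left u)
qed

text \<open>Coefficient form of Heine's (q-Euler) transformation of a 2phi1 with lower parameter
  \<open>p\<close>; for \<open>g = p ^ N\<close> it amounts to the q-Pfaff-Saalschuetz formula. It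
  follows by iterating the recurrence, whose factor splits into linear factors under the balance
  condition.\<close>

lemma qconv_saalschutz:
  fixes p a b g :: "'a::field"
  assumes p: "\<And>i. 0 < i \<Longrightarrow> p ^ i \<noteq> 1" and g: "a * b = p * g" and nz: "a \<noteq> 0" "b \<noteq> 0"
  shows "qconv p a b g N = g ^ N * qpoch (p / a) p N * qpoch (p / b) p N / (qpoch p p N)\<^sup>2"
proof (induction N)
  case 0
  then show ?case by (simp add: qconv_def)
next
  case (Suc N)
  define M where "M = p ^ N"
  have nzM: "1 - p * M \<noteq> 0" using p[of "Suc N"] by (simp add: M_def)
  \<comment> \<open>The balance condition speaks of \<open>p * g\<close>, so the factorisation is
    checked after multiplication by \<open>p\<close>, which is nonzero because \<open>a * b\<close>
    is.\<close>
  have "p * (g * (a - p * M) * (b - p * M)) = p * ((g - M * (a + b) + p * M\<^sup>2) * (a * b))"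
    using g by algebra
  moreover have "p \<noteq> 0" using g nz by auto
  ultimately have "g * (a - p * M) * (b - p * M) = (g - M * (a + b) + p * M\<^sup>2) * (a * b)"
    by simp
  then have fac: "g - M * (a + b) + p * M\<^sup>2 = g * (1 - p / a * M) * (1 - p / b * M)"
    using nz by (simp add: divide_simps)
  have "qconv p a b g (Suc N) = (g - M * (a + b) + p * M\<^sup>2) * qconv p a b g N / (1 - p * M)\<^sup>2"
    using qconv_saalschutz_Suc[OF p g, of N] nzM by (simp add: M_def field_simps)
  also have "\<dots> = g ^ Suc N * qpoch (p / a) p (Suc N) * qpoch (p / b) p (Suc N) / (qpoch p p (Suc N))\<^sup>2"
    unfolding fac Suc by (simp add: qpoch_Suc M_def power_mult_distrib)
  finally show ?case .
qed

text \<open>For \<open>g = p ^ N\<close> the generating function is the polynomial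
  \<open>(z; p)\<^sub>N\<close>. Reading its coefficients from the top one downwards produces the
  factors of a sum that terminates through \<open>1 / p ^ N\<close>.\<close>

lemma qpoch_neg_power_eq_qbin_coeff:
  fixes p :: "'a::field"
  assumes p: "\<And>i. 0 < i \<Longrightarrow> p ^ i \<noteq> 1" and p0: "p \<noteq> 0" and "k \<le> N"
  shows "qbin_coeff p (p ^ N) N * (qpoch (1 / p ^ N) p k * p ^ k / qpoch p p k) =
    qbin_coeff p (p ^ N) (N - k)"
  using \<open>k \<le> N\<close>
proof (induction k)
  case 0
  then show ?case by simp
next
  case (Suc k)
  obtain d where d: "N = Suc (k + d)" using Suc.prems by (metis less_iff_Suc_add Suc_le_eq)
  have nz: "1 - p ^ Suc d \<noteq> 0" "1 - p ^ Suc k \<noteq> 0" using p[of "Suc d"] p[of "Suc k"] by auto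
  have "qbin_coeff p (p ^ N) N * (qpoch (1 / p ^ N) p (Suc k) * p ^ Suc k / qpoch p p (Suc k)) =
     qbin_coeff p (p ^ N) N * (qpoch (1 / p ^ N) p k * p ^ k / qpoch p p k)
       * ((1 - 1 / p ^ N * p ^ k) * p / (1 - p ^ Suc k))"
    by (simp add: qpoch_Suc)
  also have "\<dots> = qbin_coeff p (p ^ N) (N - k) * ((1 - 1 / p ^ N * p ^ k) * p / (1 - p ^ Suc k))"
    using Suc by simp
  also have "\<dots> = qbin_coeff p (p ^ N) d * ((p ^ N - p ^ d) / (1 - p ^ Suc d))
        * ((1 - 1 / p ^ N * p ^ k) * p / (1 - p ^ Suc k))"
  proof -
    have "N - k = Suc d" by (simp add: d)
    then show ?thesis by (simp only: qbin_coeff_Suc) simp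
  qed
  also have "\<dots> = qbin_coeff p (p ^ N) d"
    unfolding d using nz p0 by (simp add: divide_simps power_add) (simp add: algebra_simps)
  finally show ?case by (simp add: d)
qed

lemma terminating_sum_eq_qconv:
  fixes p b c :: "'a::field"
  assumes p: "\<And>i. 0 < i \<Longrightarrow> p ^ i \<noteq> 1" and p0: "p \<noteq> 0" and "N < n"
  shows "qbin_coeff p (p ^ N) N *
     (\<Sum>k=0..n-1. qpoch (1 / p ^ N) p k * qpoch b p k * qpoch c p k * p ^ k / (qpoch p p k) ^ 3)
     = qconv p b c (p ^ N) N"
proof -
  let ?s = "\<lambda>k. qpoch (1 / p ^ N) p k * qpoch b p k * qpoch c p k * p ^ k / (qpoch p p k) ^ 3"
  have "(\<Sum>k=0..n-1. ?s k) = (\<Sum>k\<le>N. ?s k)"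
  proof (rule sum.mono_neutral_right)
    \<comment> \<open>The factor with index \<open>N\<close> is
      \<open>1 - p ^ N / p ^ N = 0\<close>.\<close>
    have "qpoch (1 / p ^ N) p k = 0" if "N < k" for k
      using that p0 by (auto simp: qpoch_def intro!: prod_zero bexI[of _ N])
    then show "\<forall>k\<in>{0..n-1} - {..N}. ?s k = 0" by auto
  qed (use \<open>N < n\<close> in auto)
  moreover have "qbin_coeff p (p ^ N) N * ?s k =
      qpoch b p k * qpoch c p k / (qpoch p p k)\<^sup>2 * qbin_coeff p (p ^ N) (N - k)" if "k \<le> N" for k
    by (subst qpoch_neg_power_eq_qbin_coeff[OF p p0 that, symmetric])
      (simp_all add: power3_eq_cube power2_eq_square)
  ultimately show ?thesis by (simp add: qconv_def sum_distrib_left)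
qed

section \<open>Localisation at a polynomial\<close>

text \<open>Fractions with denominator coprime to \<open>P\<close> form a ring, the case
  \<open>i = 0\<close>; in general this is its ideal generated by \<open>P ^ i\<close>. Congruences
  thus become memberships, stable under the ring operations.\<close>

definition local_mult :: "rat poly \<Rightarrow> nat \<Rightarrow> rat poly fract set" where
  "local_mult P i = {to_fract (P ^ i * A) / to_fract B | A B. B \<noteq> 0 \<and> coprime B P}"

lemma local_multI:
  "f = to_fract (P ^ i * A) / to_fract B \<Longrightarrow> B \<noteq> 0 \<Longrightarrow> coprime B P \<Longrightarrow> f \<in> local_mult P i"
  unfolding local_mult_def by blast

lemma local_multE:
  assumes "f \<in> local_mult P i"
  obtains A B where "f = to_fract (P ^ i * A) / to_fract B" "B \<noteq> 0" "coprime B P"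
  using assms unfolding local_mult_def by blast

lemma local_mult_add:
  assumes "f \<in> local_mult P i" "g \<in> local_mult P i"
  shows "f + g \<in> local_mult P i"
proof -
  obtain A B where f: "f = to_fract (P ^ i * A) / to_fract B" "B \<noteq> 0" "coprime B P"
    using assms(1) by (rule local_multE)
  obtain C D where g: "g = to_fract (P ^ i * C) / to_fract D" "D \<noteq> 0" "coprime D P"
    using assms(2) by (rule local_multE)
  show ?thesis
    by (rule local_multI[of _ _ _ "A * D + C * B" "B * D"]) (use f g in \<open>simp_all add: field_simps\<close>)
qed

lemma local_mult_mult:
  assumes "f \<in> local_mult P i" "g \<in> local_mult P j"
  shows "f * g \<in> local_mult P (i + j)"
proof -
  obtain A B where f: "f = to_fract (P ^ i * A) / to_fract B" "B \<noteq> 0" "coprime B P"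
    using assms(1) by (rule local_multE)
  obtain C D where g: "g = to_fract (P ^ j * C) / to_fract D" "D \<noteq> 0" "coprime D P"
    using assms(2) by (rule local_multE)
  show ?thesis
    by (rule local_multI[of _ _ _ "A * C" "B * D"]) (use f g in \<open>simp_all add: power_add mult_ac\<close>)
qed

lemma local_mult_0 [simp]: "0 \<in> local_mult P i"
  by (rule local_multI[of _ _ _ 0 1]) simp_all

lemma local_mult_to_fract: "to_fract (P ^ i * A) \<in> local_mult P i"
  by (rule local_multI[of _ _ _ A 1]) simp_all

lemma local_mult_1 [simp]: "1 \<in> local_mult P 0"
  using local_mult_to_fract[of P 0 1] by simp

lemma local_mult_uminus:
  assumes "f \<in> local_mult P i" shows "- f \<in> local_mult P i"
  using local_mult_mult[OF local_mult_to_fract[of P 0 "-1"] assms] by simp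

lemma local_mult_diff:
  assumes "f \<in> local_mult P i" "g \<in> local_mult P i" shows "f - g \<in> local_mult P i"
  using local_mult_add[OF assms(1) local_mult_uminus[OF assms(2)]] by simp

lemma local_mult_scale:
  assumes "f \<in> local_mult P 0" "g \<in> local_mult P i"
  shows "f * g \<in> local_mult P i" "g * f \<in> local_mult P i"
  using local_mult_mult[OF assms] by (simp_all add: mult.commute)

lemma local_mult_power:
  assumes "f \<in> local_mult P 0" shows "f ^ k \<in> local_mult P 0"
  by (induction k) (simp_all add: assms local_mult_scale)

lemma local_mult_prod:
  assumes "\<And>x. x \<in> S \<Longrightarrow> f x \<in> local_mult P 0" shows "(\<Prod>x\<in>S. f x) \<in> local_mult P 0"
  using assms by (induction S rule: infinite_finite_induct) (simp_all add: local_mult_scale)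

lemma local_mult_sum:
  assumes "\<And>x. x \<in> S \<Longrightarrow> f x \<in> local_mult P i" shows "(\<Sum>x\<in>S. f x) \<in> local_mult P i"
  using assms by (induction S rule: infinite_finite_induct) (simp_all add: local_mult_add)

lemma local_mult_inverse_to_fract:
  assumes "B \<noteq> 0" "coprime B P" shows "inverse (to_fract B) \<in> local_mult P 0"
  by (rule local_multI[of _ _ _ 1 B]) (simp_all add: assms divide_inverse)

lemma local_mult_qpoch:
  assumes "a \<in> local_mult P 0" "q \<in> local_mult P 0"
  shows "qpoch a q k \<in> local_mult P 0"
  unfolding qpoch_def by (intro local_mult_prod local_mult_diff local_mult_1 local_mult_scale local_mult_power assms)

section \<open>Laurent polynomials and the congruence relation\<close>

lemma to_fract_in_laurent_polys: "to_fract p \<in> laurent_polys"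
  unfolding laurent_polys_def by (rule CollectI, rule exI[of _ p], rule exI[of _ 0]) simp

lemma qvar_nonzero [simp]: "qvar \<noteq> 0"
  by (simp add: qvar_def)

lemma to_fract_power: "to_fract (p ^ k) = to_fract p ^ k"
  by (induction k) simp_all

lemma laurent_polys_add:
  assumes "f \<in> laurent_polys" "g \<in> laurent_polys" shows "f + g \<in> laurent_polys"
proof -
  obtain p k where f: "f = to_fract p / qvar ^ k" using assms(1) by (auto simp: laurent_polys_def)
  obtain r l where g: "g = to_fract r / qvar ^ l" using assms(2) by (auto simp: laurent_polys_def)
  have "f + g = to_fract (p * [:0, 1:] ^ l + r * [:0, 1:] ^ k) / qvar ^ (k + l)"
    unfolding f g to_fract_add to_fract_mult to_fract_power qvar_def[symmetric]
    by (simp add: field_simps power_add)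
  then show ?thesis unfolding laurent_polys_def by blast
qed

lemma laurent_polys_mult:
  assumes "f \<in> laurent_polys" "g \<in> laurent_polys" shows "f * g \<in> laurent_polys"
proof -
  obtain p k where f: "f = to_fract p / qvar ^ k" using assms(1) by (auto simp: laurent_polys_def)
  obtain r l where g: "g = to_fract r / qvar ^ l" using assms(2) by (auto simp: laurent_polys_def)
  have "f * g = to_fract (p * r) / qvar ^ (k + l)"
    unfolding f g by (simp add: power_add)
  then show ?thesis unfolding laurent_polys_def by blast
qed

lemma laurent_coprime_to_fract:
  assumes "coprime B P" shows "laurent_coprime (to_fract B) (to_fract P)"
  unfolding laurent_coprime_def
proof (intro ballI impI)
  fix d assume "laurent_dvd d (to_fract B)" "laurent_dvd d (to_fract P)"
  then obtain b c where b: "b \<in> laurent_polys" "to_fract B = d * b"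
    and c: "c \<in> laurent_polys" "to_fract P = d * c"
    unfolding laurent_dvd_def by blast
  \<comment> \<open>A Bezout relation over the rationals shows that every common Laurent divisor
    divides 1.\<close>
  obtain u v where "u * B + v * P = 1"
    using assms bezout_coefficients_fst_snd[of B P] by (metis coprime_imp_gcd_eq_1)
  then have "to_fract u * to_fract B + to_fract v * to_fract P = 1"
    by (simp flip: to_fract_mult to_fract_add)
  then have "1 = d * (to_fract u * b + to_fract v * c)"
    by (simp add: b c algebra_simps)
  moreover have "to_fract u * b + to_fract v * c \<in> laurent_polys"
    by (intro laurent_polys_add laurent_polys_mult to_fract_in_laurent_polys b c)
  ultimately show "laurent_dvd d 1" unfolding laurent_dvd_def by blast
qed

lemma ratfun_cong_0_local:
  assumes "f \<in> local_mult P i" shows "ratfun_cong f 0 (P ^ i)"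
proof -
  obtain A B where f: "f = to_fract (P ^ i * A) / to_fract B" "B \<noteq> 0" "coprime B P"
    using assms by (rule local_multE)
  have "laurent_coprime (to_fract B) (to_fract (P ^ i))"
    using f by (intro laurent_coprime_to_fract) simp
  moreover have "laurent_dvd (to_fract (P ^ i)) (to_fract (P ^ i * A))"
    unfolding laurent_dvd_def by (intro bexI[of _ "to_fract A"]) (simp_all add: to_fract_in_laurent_polys)
  ultimately show ?thesis
    unfolding ratfun_cong_def
    using f to_fract_in_laurent_polys[of "P ^ i * A"] to_fract_in_laurent_polys[of B]
    by (metis diff_zero to_fract_eq_0_iff)
qed

section \<open>Cyclotomic polynomials and the congruences\<close>

lemma prod_cyclotomic:
  assumes "n > 0" shows "(\<Prod>d | d dvd n. cyclotomic d) = monom 1 n - 1"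
proof (rule map_poly_of_rat_inj)
  have "d > 0" if "d dvd n" for d using that assms by (auto intro: Nat.gr0I)
  then have "map_poly of_rat (\<Prod>d | d dvd n. cyclotomic d) =
      (\<Prod>d | d dvd n. \<Prod>z\<in>primitive_unity_roots d. [:-z, 1:])"
    by (auto simp: map_poly_of_rat_prod map_poly_cyclotomic intro!: prod.cong)
  also have "\<dots> = monom 1 n - 1" by (rule unity_poly_eq_prod_primitive[OF assms, symmetric])
  also have "\<dots> = map_poly of_rat (monom 1 n - 1)"
    by (simp add: map_poly_of_rat_diff map_poly_monom)
  finally show "map_poly (of_rat :: rat \<Rightarrow> complex) (\<Prod>d | d dvd n. cyclotomic d) =
    map_poly of_rat (monom 1 n - 1)" .
qed

lemma cyclotomic_dvd_monom_diff_1: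
  assumes "n dvd k" shows "cyclotomic n dvd monom 1 k - 1"
proof (cases "k = 0")
  case True
  then show ?thesis by (simp add: monom_0 one_pCons)
next
  case False
  then show ?thesis using assms
    by (simp flip: prod_cyclotomic add: dvd_prodI)
qed

text \<open>A common divisor of positive degree would have a complex root \<open>z\<close>. It would
  be a primitive \<open>n\<close>-th root of unity with \<open>z ^ k = 1\<close>, which forces
  \<open>n\<close> to divide \<open>k\<close>.\<close>

lemma coprime_monom_diff_1_cyclotomic:
  assumes n: "n > 0" and "\<not> n dvd k"
  shows "coprime (monom 1 k - 1) (cyclotomic n)"
proof (rule coprimeI)
  fix d :: "rat poly" assume dk: "d dvd monom 1 k - 1" and dn: "d dvd cyclotomic n"
  let ?m = "map_poly (of_rat :: rat \<Rightarrow> complex)"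
  have dvd: "?m a dvd ?m b" if "a dvd b" for a b
    using that by (auto simp: map_poly_of_rat_mult elim!: dvdE)
  have "cyclotomic n \<noteq> 0"
    using map_poly_cyclotomic[OF n] finite_primitive_unity_roots[OF n] by (auto simp: prod_zero_iff)
  then have d0: "d \<noteq> 0" using dn by auto
  show "is_unit d"
  proof (rule ccontr)
    assume "\<not> is_unit d"
    then have "degree (?m d) > 0" using d0 by (simp add: is_unit_iff_degree degree_map_poly)
    then obtain z where z: "poly (?m d) z = 0" using alg_closed_imp_poly_has_root by blast
    have "poly (?m (cyclotomic n)) z = 0"
      using dvd[OF dn] z by (auto elim!: dvdE)
    then have "z \<in> primitive_unity_roots n"
      using finite_primitive_unity_roots[OF n]
      by (auto simp: map_poly_cyclotomic[OF n] poly_prod prod_zero_iff)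
    then have zn: "z ^ n = 1" and prim: "\<And>m. 0 < m \<Longrightarrow> m < n \<Longrightarrow> z ^ m \<noteq> 1"
      by (auto simp: primitive_unity_roots_def)
    have "poly (?m (monom 1 k - 1)) z = 0"
      using dvd[OF dk] z by (auto elim!: dvdE)
    then have "z ^ k = 1" by (simp add: map_poly_of_rat_diff map_poly_monom poly_monom)
    moreover have "z ^ k = z ^ (n * (k div n) + k mod n)" by simp
    ultimately have "z ^ (k mod n) = 1" using zn by (simp only: power_add power_mult) simp
    then have "k mod n = 0" using prim[of "k mod n"] n by (cases "k mod n = 0") auto
    then show False using \<open>\<not> n dvd k\<close> by auto
  qed
qed

section \<open>Powers of q in the localisation\<close>

lemma to_fract_monom: "to_fract (monom 1 k) = qvar ^ k"
  by (simp only: monom_altdef smult_1_left qvar_def to_fract_power)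

lemma monom_neq_1:
  assumes "0 < k" shows "monom 1 k \<noteq> (1 :: 'a::comm_semiring_1 poly)"
proof
  assume "monom 1 k = (1 :: 'a poly)"
  then have "degree (monom 1 k :: 'a poly) = degree (1 :: 'a poly)" by (rule arg_cong)
  then show False using assms by (simp add: degree_monom_eq)
qed

lemma qvar_power_neq_1:
  assumes "0 < k" shows "qvar ^ k \<noteq> 1"
proof -
  have "monom 1 k \<noteq> (1 :: rat poly)" by (rule monom_neq_1[OF assms])
  then have "to_fract (monom 1 k :: rat poly) \<noteq> to_fract 1" by (simp only: to_fract_eq_iff not_False_eq_True)
  then show ?thesis by (simp add: to_fract_monom)
qed

lemma local_mult_qvar_powi:
  assumes n: "n > 0" shows "qvar powi m \<in> local_mult (cyclotomic n) 0"
proof -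
  have q: "qvar \<in> local_mult (cyclotomic n) 0"
    using local_mult_to_fract[of _ 0 "[:0, 1:]"] by (simp add: qvar_def)
  \<comment> \<open>For negative exponents q must be invertible: a common divisor of q and the
    cyclotomic polynomial divides both \<open>q ^ n\<close> and \<open>q ^ n - 1\<close>.\<close>
  have "coprime (monom 1 1) (cyclotomic n)"
  proof (rule coprimeI)
    fix d :: "rat poly" assume d: "d dvd monom 1 1" "d dvd cyclotomic n"
    then have "d dvd monom 1 n - 1" using cyclotomic_dvd_monom_diff_1[of n n] by (auto intro: dvd_trans)
    moreover have "monom 1 n = monom 1 1 * (monom 1 (n - 1) :: rat poly)"
      using n by (simp add: mult_monom)
    then have "d dvd monom 1 n" using d by simp
    ultimately have "d dvd monom 1 n - (monom 1 n - 1)" by (rule dvd_diff[rotated])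
    then show "is_unit d" by simp
  qed
  then have "inverse qvar \<in> local_mult (cyclotomic n) 0"
    using local_mult_inverse_to_fract[of "monom 1 1"] by (simp add: to_fract_monom del: One_nat_def)
  then show ?thesis using q by (cases m) (simp_all add: power_int_def local_mult_power)
qed

text \<open>Negative exponents reduce to positive ones by
  \<open>1 - q ^ (-k) = q ^ (-k) * (q ^ k - 1)\<close>; in both cases \<open>u\<close> is a unit of
  the localisation at a cyclotomic polynomial.\<close>

lemma one_minus_qvar_powi_cases:
  obtains u k where "u \<in> {- 1, qvar powi m}" "1 - qvar powi m = u * to_fract (monom 1 k - 1)" "int k = \<bar>m\<bar>"
proof (cases "m \<ge> 0")
  case True
  then show ?thesis
    by (intro that[of "-1" "nat m"]) (simp_all add: to_fract_monom power_int_def)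
next
  case False
  then show ?thesis
    by (intro that[of "qvar powi m" "nat (- m)"])
      (simp_all add: to_fract_monom power_int_def right_diff_distrib flip: power_mult_distrib)
qed

lemma local_mult_one_minus_qvar_powi:
  assumes n: "n > 0" and "int n dvd m"
  shows "1 - qvar powi m \<in> local_mult (cyclotomic n) 1"
proof -
  obtain u k where u: "u \<in> {- 1, qvar powi m}" and
    eq: "1 - qvar powi m = u * to_fract (monom 1 k - 1)" and k: "int k = \<bar>m\<bar>"
    by (rule one_minus_qvar_powi_cases)
  have "int n dvd int k" using assms k by simp
  then have "n dvd k" by simp
  then obtain A where "monom 1 k - 1 = cyclotomic n * A"
    using cyclotomic_dvd_monom_diff_1 by blast
  then have "to_fract (monom 1 k - 1) \<in> local_mult (cyclotomic n) 1"
    using local_mult_to_fract[of "cyclotomic n" 1 A] by simp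
  moreover have "u \<in> local_mult (cyclotomic n) 0"
    using u local_mult_qvar_powi[OF n] local_mult_uminus[OF local_mult_1] by auto
  ultimately show ?thesis unfolding eq by (intro local_mult_scale)
qed

lemma local_mult_inverse_one_minus_qvar_power:
  assumes n: "n > 0" and "\<not> n dvd k"
  shows "inverse (1 - qvar ^ k) \<in> local_mult (cyclotomic n) 0"
proof -
  have "k > 0" using assms by (auto intro: Nat.gr0I)
  then have "monom 1 k - 1 \<noteq> (0 :: rat poly)" using monom_neq_1[of k, where 'a = rat] by simp
  then have "inverse (to_fract (monom 1 k - 1)) \<in> local_mult (cyclotomic n) 0"
    using coprime_monom_diff_1_cyclotomic[OF assms] by (rule local_mult_inverse_to_fract)
  from local_mult_uminus[OF this] show ?thesis
    unfolding to_fract_diff to_fract_monom to_fract_1 by (metis inverse_minus_eq minus_diff_eq)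
qed

section \<open>Shifted factorials modulo cyclotomic polynomials\<close>

lemma qpoch_qvar_powi:
  "qpoch (qvar powi m) (qvar ^ 6) k = (\<Prod>j<k. 1 - qvar powi (m + 6 * int j))"
proof -
  have "qvar powi (m + 6 * int j) = qvar powi m * (qvar ^ 6) ^ j" for j
    by (simp add: power_int_add power_int_mult)
  then show ?thesis by (simp add: qpoch_def)
qed

lemma local_mult_qpoch_qvar_powi:
  assumes n: "n > 0" and j: "j < k" "int n dvd m + 6 * int j"
  shows "qpoch (qvar powi m) (qvar ^ 6) k \<in> local_mult (cyclotomic n) 1"
proof -
  let ?f = "\<lambda>j. 1 - qvar powi (m + 6 * int j)"
  have "(\<Prod>i<k. ?f i) = ?f j * (\<Prod>i\<in>{..<k} - {j}. ?f i)"
    using j by (intro prod.remove) auto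
  moreover have "(\<Prod>i\<in>{..<k} - {j}. ?f i) \<in> local_mult (cyclotomic n) 0"
    by (intro local_mult_prod local_mult_diff local_mult_1 local_mult_qvar_powi n)
  ultimately show ?thesis
    unfolding qpoch_qvar_powi using local_mult_one_minus_qvar_powi[OF n j(2)]
    by (simp only: local_mult_scale)
qed

text \<open>One factor at a time: \<open>(1 - r)\<^sup>2 - (1 - r / x) * (1 - r * x) = r * (1 -
  x)\<^sup>2 / x\<close>, and \<open>(1 - x)\<^sup>2\<close> lies in the ideal of
  \<open>P\<^sup>2\<close>.\<close>

lemma qpoch_perturb:
  assumes L: "a \<in> local_mult P 0" "q \<in> local_mult P 0" "x \<in> local_mult P 0" "inverse x \<in> local_mult P 0"
    and x1: "1 - x \<in> local_mult P 1" and x0: "x \<noteq> 0"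
  shows "(qpoch a q k)\<^sup>2 - qpoch (a / x) q k * qpoch (a * x) q k \<in> local_mult P 2"
proof (induction k)
  case 0
  then show ?case by simp
next
  case (Suc k)
  define r where "r = a * q ^ k"
  define A where "A = qpoch (a / x) q k * qpoch (a * x) q k"
  define C where "C = qpoch a q k"
  have r: "r \<in> local_mult P 0"
    unfolding r_def by (intro local_mult_scale local_mult_power L)
  have rx: "r * x \<in> local_mult P 0" "r * inverse x \<in> local_mult P 0"
    using r L by (simp_all add: local_mult_scale)
  have C: "C\<^sup>2 \<in> local_mult P 0"
    unfolding C_def by (intro local_mult_power local_mult_qpoch L)
  have sq: "(1 - x) * (1 - x) \<in> local_mult P 2"
    using local_mult_mult[OF x1 x1] by (simp add: numeral_2_eq_2)
  have "(qpoch a q (Suc k))\<^sup>2 - qpoch (a / x) q (Suc k) * qpoch (a * x) q (Suc k)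
      = C\<^sup>2 * (1 - r)\<^sup>2 - A * ((1 - r * inverse x) * (1 - r * x))"
    by (simp add: qpoch_Suc A_def C_def r_def divide_inverse power_mult_distrib mult_ac)
  also have "\<dots> = (C\<^sup>2 - A) * ((1 - r * inverse x) * (1 - r * x))
      + (C\<^sup>2 * (r * inverse x)) * ((1 - x) * (1 - x))"
    using x0 by (simp add: divide_simps) (simp add: algebra_simps power2_eq_square)
  also have "\<dots> \<in> local_mult P 2"
  proof (rule local_mult_add)
    have "(1 - r * inverse x) * (1 - r * x) \<in> local_mult P 0"
      by (rule local_mult_scale) (rule local_mult_diff[OF local_mult_1], rule rx)+
    moreover have "C\<^sup>2 - A \<in> local_mult P 2" using Suc by (simp only: A_def C_def)
    ultimately show "(C\<^sup>2 - A) * ((1 - r * inverse x) * (1 - r * x)) \<in> local_mult P 2"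
      by (rule local_mult_scale)
    show "(C\<^sup>2 * (r * inverse x)) * ((1 - x) * (1 - x)) \<in> local_mult P 2"
      by (rule local_mult_scale(1)[OF local_mult_scale(1)[OF C rx(2)] sq])
  qed
  finally show ?case .
qed

lemma local_mult_inverse_qpoch_self:
  assumes n: "n > 0" "coprime n 6" and "k < n"
  shows "inverse (qpoch (qvar ^ 6) (qvar ^ 6) k) \<in> local_mult (cyclotomic n) 0"
proof -
  have "inverse (1 - qvar ^ 6 * (qvar ^ 6) ^ j) \<in> local_mult (cyclotomic n) 0" if "j < k" for j
  proof -
    have "\<not> n dvd Suc j" using that \<open>k < n\<close> by (auto dest: dvd_imp_le)
    then have "\<not> n dvd 6 * Suc j" using n(2) by (simp only: coprime_dvd_mult_right_iff not_False_eq_True)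
    from local_mult_inverse_one_minus_qvar_power[OF n(1) this] show ?thesis
      by (simp only: power_mult power_Suc)
  qed
  then show ?thesis
    unfolding qpoch_def prod_inversef[symmetric] comp_def by (intro local_mult_prod) auto
qed

lemma qvar6_power_neq_1: "0 < i \<Longrightarrow> (qvar ^ 6) ^ i \<noteq> 1"
  using qvar_power_neq_1[of "6 * i"] by (simp add: power_mult)

text \<open>Needed to divide by the prefactor in \<open>terminating_sum_eq_qconv\<close>. Up to a
  power of q, its numerator factors are \<open>1 - q ^ (6 * (N - i))\<close> with
  \<open>0 < N - i < n\<close>, and \<open>n\<close> is prime to 6.\<close>

lemma local_mult_qbin_coeff_inverse:
  assumes n: "n > 0" "coprime n 6" and "N < n"
  shows "qbin_coeff (qvar ^ 6) ((qvar ^ 6) ^ N) N \<noteq> 0"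
    and "inverse (qbin_coeff (qvar ^ 6) ((qvar ^ 6) ^ N) N) \<in> local_mult (cyclotomic n) 0"
proof -
  let ?p = "qvar ^ 6"
  have eq: "?p ^ N - ?p ^ i = - (?p ^ i * (1 - qvar ^ (6 * (N - i))))" if "i < N" for i
    using that by (simp add: right_diff_distrib power_mult flip: power_add)
  have "?p ^ N - ?p ^ i \<noteq> 0" if "i < N" for i
    using eq[OF that] qvar_power_neq_1[of "6 * (N - i)"] that by auto
  then show "qbin_coeff ?p (?p ^ N) N \<noteq> 0"
    using qpoch_self_nonzero[OF qvar6_power_neq_1] by (simp add: qbin_coeff_def prod_zero_iff)
  have "inverse (?p ^ N - ?p ^ i) \<in> local_mult (cyclotomic n) 0" if "i < N" for i
  proof -
    have "\<not> n dvd N - i" using that \<open>N < n\<close> by (auto dest: dvd_imp_le)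
    then have "\<not> n dvd 6 * (N - i)" using n(2) by (simp only: coprime_dvd_mult_right_iff not_False_eq_True)
    moreover have "inverse (?p ^ i) = qvar powi (- int (6 * i))"
      by (simp only: power_int_minus power_int_of_nat power_mult)
    ultimately show ?thesis
      unfolding eq[OF that] inverse_minus_eq inverse_mult_distrib
      by (intro local_mult_uminus local_mult_scale local_mult_inverse_one_minus_qvar_power)
        (simp_all add: n local_mult_qvar_powi)
  qed
  moreover have "inverse (qbin_coeff ?p (?p ^ N) N) = qpoch ?p ?p N * (\<Prod>i<N. inverse (?p ^ N - ?p ^ i))"
    by (simp add: qbin_coeff_def divide_inverse flip: prod_inversef)
  moreover have "?p \<in> local_mult (cyclotomic n) 0"
    using local_mult_qvar_powi[OF n(1), of 6] by simp
  ultimately show "inverse (qbin_coeff ?p (?p ^ N) N) \<in> local_mult (cyclotomic n) 0"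
    by (simp only:) (intro local_mult_scale local_mult_qpoch local_mult_prod, auto)
qed

text \<open>With \<open>x = q ^ e\<close>, the condition on \<open>r - e\<close> says that
  \<open>a / x = p ^ (-N)\<close>, so the perturbed sum terminates and is a convolution up to an
  invertible factor.\<close>

lemma ratfun_cong_0_qconv:
  assumes n: "n > 0" "coprime n 6" and N: "N < n" "int n dvd e" "r - e = - 6 * int N"
    and conv: "qconv (qvar ^ 6) (qvar powi (r + e)) (qvar powi s) ((qvar ^ 6) ^ N) N
      \<in> local_mult (cyclotomic n) 2"
  shows "ratfun_cong (\<Sum>k=0..n-1. (qpoch (qvar powi r) (qvar ^ 6) k)\<^sup>2
      * qpoch (qvar powi s) (qvar ^ 6) k * qvar ^ (6 * k) / (qpoch (qvar ^ 6) (qvar ^ 6) k) ^ 3)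
     0 ((cyclotomic n)\<^sup>2)"
proof (rule ratfun_cong_0_local)
  let ?L = "local_mult (cyclotomic n)"
  define p where "p = qvar ^ 6"
  define x where "x = qvar powi e"
  define a where "a = qvar powi r"
  define c where "c = qvar powi s"
  have L: "a \<in> ?L 0" "p \<in> ?L 0" "x \<in> ?L 0" "inverse x \<in> ?L 0" "c \<in> ?L 0"
    using local_mult_qvar_powi[OF n(1)] local_mult_qvar_powi[OF n(1), of 6]
    by (simp_all add: a_def p_def x_def c_def flip: power_int_minus)
  have x1: "1 - x \<in> ?L 1" unfolding x_def by (rule local_mult_one_minus_qvar_powi[OF n(1) N(2)])
  have x0: "x \<noteq> 0" and p0: "p \<noteq> 0" by (simp_all add: x_def p_def)
  have p1: "0 < i \<Longrightarrow> p ^ i \<noteq> 1" for i unfolding p_def by (rule qvar6_power_neq_1)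
  have "a / x = qvar powi (- 6 * int N)" by (simp add: a_def x_def N(3) flip: power_int_diff)
  also have "\<dots> = 1 / p ^ N"
    by (simp add: p_def power_int_minus divide_inverse power_int_mult)
  finally have ax: "a / x = 1 / p ^ N" .
  have ax': "a * x = qvar powi (r + e)" by (simp add: a_def x_def power_int_add)
  let ?w = "\<lambda>k. qpoch c p k * p ^ k * (inverse (qpoch p p k)) ^ 3"
  let ?S = "\<Sum>k=0..n-1. (qpoch a p k)\<^sup>2 * qpoch c p k * p ^ k / (qpoch p p k) ^ 3"
  let ?T = "\<Sum>k=0..n-1. qpoch (1 / p ^ N) p k * qpoch (a * x) p k * qpoch c p k * p ^ k / (qpoch p p k) ^ 3"
  have "((qpoch a p k)\<^sup>2 - qpoch (a / x) p k * qpoch (a * x) p k) * ?w k \<in> ?L 2" if "k < n" for k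
    using qpoch_perturb[OF L(1-4) x1 x0] local_mult_inverse_qpoch_self[OF n that]
    by (intro local_mult_scale local_mult_power local_mult_qpoch L) (simp_all add: p_def)
  then have "(\<Sum>k=0..n-1. ((qpoch a p k)\<^sup>2 - qpoch (a / x) p k * qpoch (a * x) p k) * ?w k) \<in> ?L 2"
    using n(1) by (intro local_mult_sum) auto
  also have "(\<Sum>k=0..n-1. ((qpoch a p k)\<^sup>2 - qpoch (a / x) p k * qpoch (a * x) p k) * ?w k) = ?S - ?T"
    unfolding ax by (simp add: left_diff_distrib sum_subtractf divide_inverse power_inverse mult.assoc)
  finally have "?S - ?T \<in> ?L 2" .
  moreover have "?T \<in> ?L 2"
  proof -
    let ?\<kappa> = "qbin_coeff p (p ^ N) N"
    have "?\<kappa> \<noteq> 0" "inverse ?\<kappa> \<in> ?L 0"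
      unfolding p_def by (rule local_mult_qbin_coeff_inverse[OF n N(1)])+
    moreover have "?\<kappa> * ?T \<in> ?L 2"
      using terminating_sum_eq_qconv[OF p1 p0 N(1), where b = "a * x" and c = c] conv
      by (simp only: ax' p_def c_def)
    ultimately have "inverse ?\<kappa> * (?\<kappa> * ?T) \<in> ?L 2" by (blast intro: local_mult_scale(1))
    then show ?thesis using \<open>?\<kappa> \<noteq> 0\<close> by (simp flip: mult.assoc)
  qed
  ultimately have "?S - ?T + ?T \<in> ?L 2" by (rule local_mult_add)
  then show "(\<Sum>k=0..n-1. (qpoch (qvar powi r) (qvar ^ 6) k)\<^sup>2
      * qpoch (qvar powi s) (qvar ^ 6) k * qvar ^ (6 * k) / (qpoch (qvar ^ 6) (qvar ^ 6) k) ^ 3)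
    \<in> ?L 2"
    by (simp add: a_def c_def p_def power_mult)
qed

text \<open>The equation for \<open>t\<close> is the balance condition. The indices \<open>i\<close>
  and \<open>j\<close> locate one factor divisible by the cyclotomic polynomial in each shifted
  factorial of the closed form, and \<open>N < n\<close> keeps the denominator invertible.\<close>

lemma local_mult_qconv_saalschutz:
  assumes n: "n > 0" "coprime n 6" and "N < n" and t: "r + s = t + 6"
    and i: "i < N" "int n dvd 6 - r + 6 * int i" and j: "j < N" "int n dvd 6 - s + 6 * int j"
  shows "qconv (qvar ^ 6) (qvar powi r) (qvar powi s) (qvar powi t) N \<in> local_mult (cyclotomic n) 2"
proof -
  let ?p = "qvar ^ 6" and ?L = "local_mult (cyclotomic n)"
  have g: "qvar powi r * qvar powi s = ?p * qvar powi t"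
    using t by (simp add: power_int_add[of qvar t 6] mult.commute flip: power_int_add[of qvar r s])
  have quot: "?p / qvar powi m = qvar powi (6 - m)" for m
    by (simp add: power_int_diff)
  have "qconv ?p (qvar powi r) (qvar powi s) (qvar powi t) N =
      ((qvar powi t) ^ N * (inverse (qpoch ?p ?p N))\<^sup>2) *
      (qpoch (qvar powi (6 - r)) ?p N * qpoch (qvar powi (6 - s)) ?p N)"
    by (subst qconv_saalschutz[OF qvar6_power_neq_1 g], simp_all only: quot)
      (simp_all add: divide_inverse power_inverse mult_ac)
  moreover have "qpoch (qvar powi (6 - r)) ?p N * qpoch (qvar powi (6 - s)) ?p N \<in> ?L (1 + 1)"
    by (intro local_mult_mult local_mult_qpoch_qvar_powi[OF n(1) i] local_mult_qpoch_qvar_powi[OF n(1) j])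
  moreover have "(qvar powi t) ^ N * (inverse (qpoch ?p ?p N))\<^sup>2 \<in> ?L 0"
    by (intro local_mult_scale local_mult_power local_mult_qvar_powi n local_mult_inverse_qpoch_self \<open>N < n\<close>)
  ultimately show ?thesis by (simp add: local_mult_scale numeral_2_eq_2)
qed

theorem theorem1p3:
  fixes n :: nat
  assumes "n > 1"
  shows
    "([n = 5] (mod 6) \<longrightarrow>
       ratfun_cong
         (\<Sum>k=0..n-1. (qpoch qvar (qvar ^ 6) k)\<^sup>2 * qpoch (qvar ^ 4) (qvar ^ 6) k * qvar ^ (6 * k)
            / (qpoch (qvar ^ 6) (qvar ^ 6) k) ^ 3)
         0 ((cyclotomic n)\<^sup>2)) \<and>
     ([n = 1] (mod 6) \<longrightarrow>
       ratfun_cong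
         (\<Sum>k=0..n-1. (qpoch (qvar powi -1) (qvar ^ 6) k)\<^sup>2 * qpoch (qvar powi -4) (qvar ^ 6) k * qvar ^ (6 * k)
            / (qpoch (qvar ^ 6) (qvar ^ 6) k) ^ 3)
         0 ((cyclotomic n)\<^sup>2))"
proof (intro conjI impI)
  assume "[n = 5] (mod 6)"
  then have "n mod 6 = 5" by (simp add: cong_def)
  define m where "m = n div 6"
  have m: "n = 6 * m + 5" using \<open>n mod 6 = 5\<close> unfolding m_def by presburger
  have cop: "coprime n 6"
    using coprime_Suc_right_nat[of 5] \<open>n mod 6 = 5\<close> coprime_mod_left_iff[of 6 n] by simp
  \<comment> \<open>Solves \<open>1 - 5 * n = - 6 * N\<close>. The sum is then balanced:
    \<open>(1 + 5 * n) + 4 = 6 * N + 6\<close>.\<close>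
  define N where "N = 5 * m + 4"
  have pN: "(qvar ^ 6) ^ N = qvar powi (6 * int N)"
    by (simp add: power_int_mult)
  have "qconv (qvar ^ 6) (qvar powi (1 + 5 * int n)) (qvar powi 4) ((qvar ^ 6) ^ N) N
      \<in> local_mult (cyclotomic n) 2"
    unfolding pN
  \<comment> \<open>The two chosen factors have exponents \<open>-4 * n\<close> and
    \<open>4 * n\<close>.\<close>
  proof (rule local_mult_qconv_saalschutz[where i = m and j = "4 * m + 3"])
    show "int n dvd 6 - (1 + 5 * int n) + 6 * int m"
      by (rule dvdI[of _ _ "-4"]) (simp add: m)
    show "int n dvd 6 - 4 + 6 * int (4 * m + 3)"
      by (rule dvdI[of _ _ 4]) (simp add: m)
  qed (use cop in \<open>auto simp: m N_def\<close>)
  from ratfun_cong_0_qconv[of n N "5 * int n" 1 4, OF _ cop _ dvd_triv_right _ this]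
  show "ratfun_cong
         (\<Sum>k=0..n-1. (qpoch qvar (qvar ^ 6) k)\<^sup>2 * qpoch (qvar ^ 4) (qvar ^ 6) k * qvar ^ (6 * k)
            / (qpoch (qvar ^ 6) (qvar ^ 6) k) ^ 3)
         0 ((cyclotomic n)\<^sup>2)"
    by (simp add: m N_def)
next
  assume "[n = 1] (mod 6)"
  then have "n mod 6 = 1" by (simp add: cong_def)
  \<comment> \<open>As \<open>n > 1\<close>, the smallest case is \<open>n = 7\<close>; this shift
    ensures \<open>5 * m + 6 < n\<close> below.\<close>
  define m where "m = n div 6 - 1"
  have m: "n = 6 * m + 7" using \<open>n mod 6 = 1\<close> assms unfolding m_def by presburger
  have cop: "coprime n 6"
    using \<open>n mod 6 = 1\<close> by (metis coprime_mod_left_iff coprime_1_left zero_neq_numeral)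
  let ?L = "local_mult (cyclotomic n)"
  \<comment> \<open>Termination requires \<open>- 1 - 5 * n = - 6 * N\<close>, so
    \<open>N = K + 2\<close>, whereas balance \<open>b * c = p * g\<close> holds for
    \<open>g = p ^ K\<close>.\<close>
  define K where "K = 5 * m + 4"
  define p where "p = qvar ^ 6"
  define g where "g = qvar powi (6 * int K)"
  define b where "b = qvar powi (- 1 + 5 * int n)"
  define c where "c = qvar powi (- 4)"
  have p1: "0 < i \<Longrightarrow> p ^ i \<noteq> 1" for i unfolding p_def by (rule qvar6_power_neq_1)
  have L: "p \<in> ?L 0" "g \<in> ?L 0"
    using local_mult_qvar_powi[of n] local_mult_qvar_powi[of n 6] assms by (simp_all add: p_def g_def)
  have pN: "p ^ Suc (Suc K) = p * (p * g)"
    by (simp add: p_def g_def power_int_mult)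
  have conv: "qconv p b c g j \<in> ?L 2" if "K \<le> j" "j < n" for j
    unfolding p_def b_def c_def g_def
  proof (rule local_mult_qconv_saalschutz[where i = m and j = "4 * m + 3"])
    show "int n dvd 6 - (- 1 + 5 * int n) + 6 * int m"
      by (rule dvdI[of _ _ "-4"]) (simp add: m)
    show "int n dvd 6 - (- 4) + 6 * int (4 * m + 3)"
      by (rule dvdI[of _ _ 4]) (simp add: m)
  qed (use cop that in \<open>auto simp: m K_def\<close>)
  \<comment> \<open>Two shifts lead from \<open>p ^ N\<close> down to the balanced \<open>g\<close>,
    leaving the orders \<open>K\<close>, \<open>K + 1\<close> and \<open>K + 2\<close>, all less
    than \<open>n\<close> and covered by \<open>conv\<close>.\<close>
  have "qconv p b c (p * (p * g)) (Suc (Suc K)) =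
      qconv p b c g (Suc (Suc K)) - g * qconv p b c g (Suc K)
      - (p * g) * (qconv p b c g (Suc K) - g * qconv p b c g K)"
    by (simp only: qconv_shift[OF p1])
  also have "\<dots> \<in> ?L 2"
    by (intro local_mult_diff local_mult_scale conv L) (simp_all add: m K_def)
  finally have "qconv p b c (p ^ Suc (Suc K)) (Suc (Suc K)) \<in> ?L 2" unfolding pN .
  then show "ratfun_cong
       (\<Sum>k=0..n-1. (qpoch (qvar powi -1) (qvar ^ 6) k)\<^sup>2 * qpoch (qvar powi -4) (qvar ^ 6) k * qvar ^ (6 * k)
            / (qpoch (qvar ^ 6) (qvar ^ 6) k) ^ 3)
         0 ((cyclotomic n)\<^sup>2)"
    unfolding p_def b_def c_def
    by (intro ratfun_cong_0_qconv[where N = "Suc (Suc K)" and e = "5 * int n"] cop dvd_triv_right)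
      (simp_all add: m K_def)
qed

end
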